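(* Let $\mathsf{n}$ be a reducible BK-tuple of linear subspaces of a finite-dimensional vector space $V$ over a field $\mathbb{K}$, let $\mathcal{L}$ be the distributive lattice of BK-subtuples of $\mathsf{n}$, and let $P$ be the poset of join-irreducible elements of $\mathcal{L}$, so that by Birkhoff's theorem $\mathcal{L}$ is isomorphic to the lattice of order ideals of $P$ via $I\mapsto\bigcup_{\alpha\in I}\alpha$. Then there is a unique partition $\mathsf{n}=\bigsqcup_{\alpha\in P}\mathsf{k}_\alpha$ of the entries of $\mathsf{n}$ into subtuples indexed by $P$ such that for every order ideal $I$ of $P$ the subtuple $\mathsf{k}_I:=\bigsqcup_{\alpha\in I}\mathsf{k}_\alpha$ is the BK-subtuple corresponding to $I$; moreover, for every $\alpha\in P$ the tuple $\hat{\mathsf{k}}_\alpha:=\mathsf{k}_{(\alpha)}/\mathsf{k}_{(\alpha)\setminus\{\alpha\}}$ is an irreducible BK-tuple, where $(\alpha)=\{\beta\in P\mid\beta\le\alpha\}$ is the principal order ideal.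
   Context: A tuple is a finite indexed family of linear subspaces of $V$ (repetitions allowed); a subtuple is a subfamily indexed by a subset of the index set, and unions, intersections and disjoint unions of subtuples are taken on index sets. For a tuple $\mathsf{h}$, $\langle\mathsf{h}\rangle=\sum_{L\in\mathsf{h}}L$ (zero for the empty tuple), $\mathfrak{c}(\mathsf{h})$ is the number of its entries, and $\delta(\mathsf{h})=\dim\langle\mathsf{h}\rangle-\mathfrak{c}(\mathsf{h})$ is its defect. A tuple is linearly independent if every subtuple (including itself) has non-negative defect; a BK-tuple is a linearly independent tuple with defect $0$. A nonempty BK-tuple is irreducible if every nonempty proper subtuple has strictly positive defect, and reducible otherwise. The BK-subtuples of a BK-tuple, ordered by inclusion, form a distributive lattice with union and intersection as join and meet. An order ideal of $P$ is a subset $I$ with $\beta\in I,\ \alpha\le\beta\Rightarrow\alpha\in I$. For subtuples $\mathsf{h}'\subseteq\mathsf{h}$, the quotient $\mathsf{h}/\mathsf{h}'$ is the tuple $(\pi(L))_{L\in\mathsf{h}\setminus\mathsf{h}'}$ of subspaces of $V/\langle\mathsf{h}'\rangle$, with $\pi:V\to V/\langle\mathsf{h}'\rangle$ the projection. *)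

theory Defs
  imports "HOL-Algebra.AbelCoset" "Jordan_Normal_Form.Missing_VectorSpace"
begin

text \<open>
  A tuple of subspaces of \<open>V\<close> is a family \<open>L\<close> of subspaces over a finite index set \<open>N\<close>; its
  subtuples are identified with the subsets of \<open>N\<close>, so that unions, intersections and inclusions
  of subtuples are literally those of index sets.  \<open>L\<close> may repeat values.
\<close>

definition subspace_tuple ::
    "('a, 'b) ring_scheme \<Rightarrow> ('a, 'c, 'd) module_scheme \<Rightarrow> ('i \<Rightarrow> 'c set) \<Rightarrow> 'i set \<Rightarrow> bool" where
  "subspace_tuple K V L N \<longleftrightarrow> finite N \<and> (\<forall>i\<in>N. subspace K (L i) V)"

definition tuple_sum :: "('a, 'c, 'd) module_scheme \<Rightarrow> ('i \<Rightarrow> 'c set) \<Rightarrow> 'i set \<Rightarrow> 'c set" where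
  "tuple_sum V L S = {finsum V x S | x. x \<in> (\<Pi> i\<in>S. L i)}"

definition defect ::
    "('a, 'b) ring_scheme \<Rightarrow> ('a, 'c, 'd) module_scheme \<Rightarrow> ('i \<Rightarrow> 'c set) \<Rightarrow> 'i set \<Rightarrow> int" where
  "defect K V L S = int (vectorspace.dim K (V\<lparr>carrier := tuple_sum V L S\<rparr>)) - int (card S)"

definition lin_indep_tuple ::
    "('a, 'b) ring_scheme \<Rightarrow> ('a, 'c, 'd) module_scheme \<Rightarrow> ('i \<Rightarrow> 'c set) \<Rightarrow> 'i set \<Rightarrow> bool" where
  "lin_indep_tuple K V L N \<longleftrightarrow> subspace_tuple K V L N \<and> (\<forall>S\<subseteq>N. 0 \<le> defect K V L S)"

definition BK_tuple ::
    "('a, 'b) ring_scheme \<Rightarrow> ('a, 'c, 'd) module_scheme \<Rightarrow> ('i \<Rightarrow> 'c set) \<Rightarrow> 'i set \<Rightarrow> bool" where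
  "BK_tuple K V L N \<longleftrightarrow> lin_indep_tuple K V L N \<and> defect K V L N = 0"

definition irreducible_BK_tuple ::
    "('a, 'b) ring_scheme \<Rightarrow> ('a, 'c, 'd) module_scheme \<Rightarrow> ('i \<Rightarrow> 'c set) \<Rightarrow> 'i set \<Rightarrow> bool" where
  "irreducible_BK_tuple K V L N \<longleftrightarrow>
     BK_tuple K V L N \<and> N \<noteq> {} \<and> (\<forall>S. S \<noteq> {} \<and> S \<subset> N \<longrightarrow> 0 < defect K V L S)"

definition reducible_BK_tuple ::
    "('a, 'b) ring_scheme \<Rightarrow> ('a, 'c, 'd) module_scheme \<Rightarrow> ('i \<Rightarrow> 'c set) \<Rightarrow> 'i set \<Rightarrow> bool" where
  "reducible_BK_tuple K V L N \<longleftrightarrow>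
     BK_tuple K V L N \<and> N \<noteq> {} \<and> \<not> irreducible_BK_tuple K V L N"

definition BK_subtuples ::
    "('a, 'b) ring_scheme \<Rightarrow> ('a, 'c, 'd) module_scheme \<Rightarrow> ('i \<Rightarrow> 'c set) \<Rightarrow> 'i set \<Rightarrow> 'i set set" where
  "BK_subtuples K V L N = {S. S \<subseteq> N \<and> BK_tuple K V L S}"

text \<open>
  Join-irreducible elements of a lattice \<open>F\<close> of sets whose join is union and whose least element
  is the empty set; as usual the least element does not count as join-irreducible.  The resulting
  set is regarded as a poset under inclusion.
\<close>

definition join_irreducibles :: "'i set set \<Rightarrow> 'i set set" where
  "join_irreducibles F =
     {A \<in> F. A \<noteq> {} \<and> (\<forall>B\<in>F. \<forall>C\<in>F. A = B \<union> C \<longrightarrow> A = B \<or> A = C)}"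

definition BK_poset ::
    "('a, 'b) ring_scheme \<Rightarrow> ('a, 'c, 'd) module_scheme \<Rightarrow> ('i \<Rightarrow> 'c set) \<Rightarrow> 'i set \<Rightarrow> 'i set set" where
  "BK_poset K V L N = join_irreducibles (BK_subtuples K V L N)"

definition order_ideals :: "'i set set \<Rightarrow> 'i set set set" where
  "order_ideals P = {I. I \<subseteq> P \<and> (\<forall>\<beta>\<in>I. \<forall>\<alpha>\<in>P. \<alpha> \<subseteq> \<beta> \<longrightarrow> \<alpha> \<in> I)}"

definition principal_ideal :: "'i set set \<Rightarrow> 'i set \<Rightarrow> 'i set set" where
  "principal_ideal P \<alpha> = {\<beta> \<in> P. \<beta> \<subseteq> \<alpha>}"

text \<open>
  The quotient of \<open>V\<close> by a subspace \<open>W\<close>, on the additive cosets of \<open>W\<close>.  The product of the scalar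
  \<open>a\<close> and a coset \<open>X\<close> is \<open>a X + W\<close> rather than \<open>a X\<close>, since the latter is not a coset for
  \<open>a = 0\<close>.  The fields \<open>mult\<close> and \<open>one\<close> are part of the record type but irrelevant for modules.
\<close>

definition quotient_space :: "('a, 'c, 'd) module_scheme \<Rightarrow> 'c set \<Rightarrow> ('a, 'c set) module" where
  "quotient_space V W =
     \<lparr>carrier = a_rcosets\<^bsub>V\<^esub> W, mult = undefined, one = undefined,
      zero = W, add = set_add V,
      smult = (\<lambda>a X. (\<lambda>x. a \<odot>\<^bsub>V\<^esub> x) ` X <+>\<^bsub>V\<^esub> W)\<rparr>"

definition quotient_proj :: "('a, 'c, 'd) module_scheme \<Rightarrow> 'c set \<Rightarrow> 'c \<Rightarrow> 'c set" where
  "quotient_proj V W v = W +>\<^bsub>V\<^esub> v"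

text \<open>
  For subtuples \<open>S \<subseteq> T\<close>, the quotient \<open>T / S\<close> is the tuple \<open>quotient_family V L S\<close> over the index
  set \<open>T - S\<close>, in the space \<open>quotient_space V (tuple_sum V L S)\<close>.
\<close>

definition quotient_family ::
    "('a, 'c, 'd) module_scheme \<Rightarrow> ('i \<Rightarrow> 'c set) \<Rightarrow> 'i set \<Rightarrow> 'i \<Rightarrow> 'c set set" where
  "quotient_family V L S i = quotient_proj V (tuple_sum V L S) ` L i"

definition subtuple_join :: "('i set \<Rightarrow> 'i set) \<Rightarrow> 'i set set \<Rightarrow> 'i set" where
  "subtuple_join k I = (\<Union>\<alpha>\<in>I. k \<alpha>)"

text \<open>
  A partition of \<open>N\<close> into pieces indexed by \<open>P\<close>; \<open>k\<close> is made extensional so that a partition is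
  determined by its values on \<open>P\<close>.
\<close>

definition indexed_partition :: "'i set set \<Rightarrow> 'i set \<Rightarrow> ('i set \<Rightarrow> 'i set) \<Rightarrow> bool" where
  "indexed_partition P N k \<longleftrightarrow>
     k \<in> extensional P \<and> disjoint_family_on k P \<and> (\<Union>\<alpha>\<in>P. k \<alpha>) = N"

text \<open>
  The element of the lattice corresponding to an order ideal \<open>I\<close> under Birkhoff's theorem is
  \<open>\<Union>I\<close>.
\<close>

definition birkhoff_partition :: "'i set set \<Rightarrow> 'i set \<Rightarrow> ('i set \<Rightarrow> 'i set) \<Rightarrow> bool" where
  "birkhoff_partition P N k \<longleftrightarrow>
     indexed_partition P N k \<and> (\<forall>I\<in>order_ideals P. subtuple_join k I = \<Union>I)"

end

theory Submission
  imports Defs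
begin

text \<open>
  The defect is submodular, since \<open>dim\<close> is modular on subspaces and
  \<open>\<langle>A \<inter> B\<rangle> \<subseteq> \<langle>A\<rangle> \<inter> \<langle>B\<rangle>\<close>.  As all defects of subtuples of a BK-tuple are non-negative, those of
  defect zero are closed under union and intersection, which makes them a finite ring of sets, where
  join-irreducible elements are join-prime.  The piece \<open>k \<alpha>\<close> can only be \<open>\<alpha>\<close> minus its unique lower
  cover \<open>S\<close>.  Finally the defect of \<open>R\<close> in the quotient by \<open>S\<close> is
  \<open>\<delta>(S \<union> R) - \<delta>(S) = \<delta>(S \<union> R)\<close>, which vanishes only for BK-subtuples between \<open>S\<close> and \<open>\<alpha>\<close>, that is
  for \<open>R\<close> empty or everything.
\<close>

subsection \<open>Birkhoff's theorem for finite rings of sets\<close>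

text \<open>Join and meet are literally union and intersection, so distributivity comes for free
  from set algebra. Finiteness of the underlying set bounds both the members of \<open>F\<close> and
  their number.\<close>

locale ring_of_sets_lattice =
  fixes F :: "'i set set"
  assumes finite_Union: "finite (\<Union>F)"
    and empty_mem: "{} \<in> F"
    and Un_mem: "A \<in> F \<Longrightarrow> B \<in> F \<Longrightarrow> A \<union> B \<in> F"
    and Int_mem: "A \<in> F \<Longrightarrow> B \<in> F \<Longrightarrow> A \<inter> B \<in> F"
begin

abbreviation "P \<equiv> join_irreducibles F"

lemma P_subset: "P \<subseteq> F"
  by (auto simp: join_irreducibles_def)

lemma finite_F: "finite F"
  using finite_Union by (rule finite_UnionD)

lemma finite_mem: "A \<in> F \<Longrightarrow> finite A"
  using finite_Union by (meson Union_upper finite_subset)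

lemma Union_mem: "X \<subseteq> F \<Longrightarrow> \<Union>X \<in> F"
proof -
  assume X: "X \<subseteq> F"
  then have "finite X"
    using finite_F finite_subset by blast
  then show ?thesis
    using X by induction (auto intro: empty_mem Un_mem)
qed

text \<open>Distributivity splits \<alpha> into its traces on \<open>B\<close> and on the rest of
  the cover; join-irreducibility makes one trace equal to \<alpha>. The empty cover is excluded
  because \<alpha> is nonempty.\<close>

lemma join_prime:
  assumes "\<alpha> \<in> P" "X \<subseteq> F" "\<alpha> \<subseteq> \<Union>X"
  shows "\<exists>\<beta>\<in>X. \<alpha> \<subseteq> \<beta>"
proof -
  have "finite X"
    using assms(2) finite_F finite_subset by blast
  then show ?thesis
    using assms(2,3)
  proof induction
    case empty
    then show ?case
      using assms(1) by (auto simp: join_irreducibles_def)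
  next
    case (insert B X)
    have "\<alpha> \<inter> B \<in> F" "\<alpha> \<inter> \<Union>X \<in> F"
      using assms(1) P_subset insert.prems by (auto intro!: Int_mem Union_mem)
    moreover have "\<alpha> = (\<alpha> \<inter> B) \<union> (\<alpha> \<inter> \<Union>X)"
      using insert.prems by auto
    ultimately consider "\<alpha> = \<alpha> \<inter> B" | "\<alpha> = \<alpha> \<inter> \<Union>X"
      using assms(1) unfolding join_irreducibles_def by blast
    then show ?case
    proof cases
      case 1
      then have "\<alpha> \<subseteq> B"
        by (simp add: inf.order_iff)
      then show ?thesis
        by blast
    next
      case 2
      then have "\<alpha> \<subseteq> \<Union>X"
        by (simp add: inf.order_iff)
      then show ?thesis
        using insert.IH insert.prems(1) by auto
    qed
  qed
qed

text \<open>Induction along proper inclusion: a nonempty member that is not join-irreducible is the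
  union of two proper submembers, and the join-irreducibles below those also lie below it.\<close>

lemma eq_Union_join_irreducibles:
  assumes "A \<in> F"
  shows "A = \<Union>{\<alpha> \<in> P. \<alpha> \<subseteq> A}"
proof -
  have "finite A"
    using assms by (rule finite_mem)
  then show ?thesis
    using assms
  proof (induction A rule: finite_psubset_induct)
    case (psubset A)
    show ?case
    proof (cases "A \<in> P \<or> A = {}")
      case False
      then obtain B C where "B \<in> F" "C \<in> F" "A = B \<union> C" "A \<noteq> B" "A \<noteq> C"
        using psubset.prems by (auto simp: join_irreducibles_def)
      then have "B = \<Union>{\<alpha> \<in> P. \<alpha> \<subseteq> B}" "C = \<Union>{\<alpha> \<in> P. \<alpha> \<subseteq> C}"
        using psubset.IH[of B] psubset.IH[of C] by auto
      then have "A \<subseteq> \<Union>{\<alpha> \<in> P. \<alpha> \<subseteq> B} \<union> \<Union>{\<alpha> \<in> P. \<alpha> \<subseteq> C}"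
        using \<open>A = B \<union> C\<close> by simp
      also have "\<dots> \<subseteq> \<Union>{\<alpha> \<in> P. \<alpha> \<subseteq> A}"
        unfolding \<open>A = B \<union> C\<close> by auto
      finally show ?thesis
        by auto
    qed auto
  qed
qed

text \<open>An ideal can be read off from its union: join-primeness places \<alpha> below a single
  member of \<open>I\<close>, and downward closure does the rest. This is what makes
  \<open>Union\<close> injective on order ideals.\<close>

lemma mem_order_ideal_iff:
  assumes "I \<in> order_ideals P"
  shows "\<alpha> \<in> I \<longleftrightarrow> \<alpha> \<in> P \<and> \<alpha> \<subseteq> \<Union>I"
proof
  have I: "I \<subseteq> P" "\<And>\<alpha> \<beta>. \<beta> \<in> I \<Longrightarrow> \<alpha> \<in> P \<Longrightarrow> \<alpha> \<subseteq> \<beta> \<Longrightarrow> \<alpha> \<in> I"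
    using assms by (auto simp: order_ideals_def)
  show "\<alpha> \<in> I" if "\<alpha> \<in> P \<and> \<alpha> \<subseteq> \<Union>I"
  proof -
    have "I \<subseteq> F"
      using I(1) P_subset by blast
    moreover have "\<alpha> \<in> P" "\<alpha> \<subseteq> \<Union>I"
      using that by auto
    ultimately obtain \<beta> where "\<beta> \<in> I" "\<alpha> \<subseteq> \<beta>"
      using join_prime by metis
    then show ?thesis
      using I(2) that by blast
  qed
qed (use assms in \<open>auto simp: order_ideals_def\<close>)

lemma Union_order_ideal_subset_iff:
  assumes "I \<in> order_ideals P" "J \<in> order_ideals P"
  shows "\<Union>I \<subseteq> \<Union>J \<longleftrightarrow> I \<subseteq> J"
proof
  show "I \<subseteq> J" if "\<Union>I \<subseteq> \<Union>J"
  proof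
    fix \<alpha> assume "\<alpha> \<in> I"
    then have "\<alpha> \<in> P" "\<alpha> \<subseteq> \<Union>J"
      using assms(1) that by (auto simp: order_ideals_def)
    then show "\<alpha> \<in> J"
      using mem_order_ideal_iff[OF assms(2)] by blast
  qed
qed auto

lemma bij_betw_Union_order_ideals: "bij_betw Union (order_ideals P) F"
proof (rule bij_betwI')
  fix A assume "A \<in> F"
  moreover have "{\<alpha> \<in> P. \<alpha> \<subseteq> A} \<in> order_ideals P"
    by (auto simp: order_ideals_def)
  ultimately show "\<exists>I\<in>order_ideals P. A = \<Union>I"
    using eq_Union_join_irreducibles by blast
next
  fix I assume "I \<in> order_ideals P"
  then show "\<Union>I \<in> F"
    using P_subset by (intro Union_mem) (auto simp: order_ideals_def)
next
  fix I J assume "I \<in> order_ideals P" "J \<in> order_ideals P"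
  then show "\<Union>I = \<Union>J \<longleftrightarrow> I = J"
    using Union_order_ideal_subset_iff[of I J] Union_order_ideal_subset_iff[of J I] by auto
qed

section \<open>Lower covers and the pieces of the partition\<close>

lemma principal_ideal_in_order_ideals:
  "principal_ideal P \<alpha> \<in> order_ideals P" "principal_ideal P \<alpha> - {\<alpha>} \<in> order_ideals P"
  by (auto simp: principal_ideal_def order_ideals_def)

lemma Union_principal_ideal: "\<alpha> \<in> P \<Longrightarrow> \<Union>(principal_ideal P \<alpha>) = \<alpha>"
  by (auto simp: principal_ideal_def)

text \<open>For \<alpha> in \<open>P\<close> this is the largest member of \<open>F\<close> properly
  inside \<alpha>. Writing it as the union of an order ideal lets the partition condition be
  evaluated there directly.\<close>

definition lower_cover :: "'i set \<Rightarrow> 'i set"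
  where "lower_cover \<alpha> = \<Union>(principal_ideal P \<alpha> - {\<alpha>})"

lemma lower_cover_mem: "lower_cover \<alpha> \<in> F"
  unfolding lower_cover_def using P_subset by (intro Union_mem) (auto simp: principal_ideal_def)

text \<open>If the join-irreducibles strictly below \<alpha> covered \<alpha>, then by
  join-primeness one of them would contain \<alpha>.\<close>

lemma lower_cover_psubset:
  assumes "\<alpha> \<in> P"
  shows "lower_cover \<alpha> \<subset> \<alpha>"
proof -
  have "\<not> \<alpha> \<subseteq> lower_cover \<alpha>"
    unfolding lower_cover_def
    using join_prime[OF assms, of "principal_ideal P \<alpha> - {\<alpha>}"] P_subset
    by (auto simp: principal_ideal_def)
  then show ?thesis
    by (auto simp: lower_cover_def principal_ideal_def)
qed

text \<open>\<open>A\<close> is the union of the join-irreducibles inside it, and none of these is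
  \<alpha> because \<open>A\<close> is a proper subset.\<close>

lemma subset_lower_cover:
  assumes "A \<in> F" "A \<subset> \<alpha>"
  shows "A \<subseteq> lower_cover \<alpha>"
proof -
  have "\<Union>{\<beta> \<in> P. \<beta> \<subseteq> A} \<subseteq> lower_cover \<alpha>"
    using assms(2) by (auto simp: lower_cover_def principal_ideal_def)
  then show ?thesis
    using eq_Union_join_irreducibles[OF assms(1)] by simp
qed

text \<open>Uniqueness: the ideals (\<alpha>) and (\<alpha>) - {\<alpha>} differ only in \<alpha>,
  so by disjointness the piece at \<alpha> is the difference of their unions.\<close>

lemma birkhoff_partition_eq:
  assumes "birkhoff_partition P N k" "\<alpha> \<in> P"
  shows "k \<alpha> = \<alpha> - lower_cover \<alpha>"
proof -
  let ?I = "principal_ideal P \<alpha>"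
  have join: "subtuple_join k I = \<Union>I" if "I \<in> order_ideals P" for I
    using assms(1) that by (simp add: birkhoff_partition_def)
  have "(\<Union>\<beta>\<in>?I. k \<beta>) = \<alpha>" "(\<Union>\<beta>\<in>?I - {\<alpha>}. k \<beta>) = lower_cover \<alpha>"
    using join[OF principal_ideal_in_order_ideals(1), of \<alpha>]
      join[OF principal_ideal_in_order_ideals(2), of \<alpha>] Union_principal_ideal[OF assms(2)]
    by (simp_all add: subtuple_join_def lower_cover_def)
  moreover have "k \<alpha> \<inter> k \<beta> = {}" if "\<beta> \<in> ?I - {\<alpha>}" for \<beta>
    using assms that
    by (auto simp: birkhoff_partition_def indexed_partition_def disjoint_family_on_def
        principal_ideal_def)
  moreover have "\<alpha> \<in> ?I"
    using assms(2) by (simp add: principal_ideal_def)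
  ultimately show ?thesis
    by blast
qed

lemma birkhoff_partition_exists:
  assumes "\<Union>F \<in> F"
  shows "birkhoff_partition P (\<Union>F) (\<lambda>\<alpha>\<in>P. \<alpha> - lower_cover \<alpha>)"
proof -
  let ?k = "\<lambda>\<alpha>\<in>P. \<alpha> - lower_cover \<alpha>"
  have "disjoint_family_on ?k P"
    unfolding disjoint_family_on_def
  proof (intro ballI impI equals0I)
    fix \<alpha> \<beta> x assume *: "\<alpha> \<in> P" "\<beta> \<in> P" "\<alpha> \<noteq> \<beta>" "x \<in> ?k \<alpha> \<inter> ?k \<beta>"
    \<comment> \<open>Since \<alpha> and \<beta> differ, their intersection is proper in at least
      one of them, hence inside its lower cover; but \<open>x\<close> avoids both lower
      covers.\<close>
    have "\<alpha> \<inter> \<beta> \<in> F"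
      using * P_subset by (auto intro: Int_mem)
    then show False
      using * subset_lower_cover[of "\<alpha> \<inter> \<beta>" \<alpha>] subset_lower_cover[of "\<alpha> \<inter> \<beta>" \<beta>] by auto
  qed
  moreover have join: "subtuple_join ?k I = \<Union>I" if I: "I \<in> order_ideals P" for I
  proof
    have "I \<subseteq> P"
      using I by (simp add: order_ideals_def)
    then show "subtuple_join ?k I \<subseteq> \<Union>I"
      by (auto simp: subtuple_join_def)
    show "\<Union>I \<subseteq> subtuple_join ?k I"
    proof
      fix x assume "x \<in> \<Union>I"
      moreover have "finite {\<beta> \<in> I. x \<in> \<beta>}"
        using \<open>I \<subseteq> P\<close> P_subset by (intro finite_subset[OF _ finite_F]) auto
      \<comment> \<open>The piece containing \<open>x\<close> belongs to a minimal member of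
        \<open>I\<close> through \<open>x\<close>: anything smaller in \<open>P\<close> is again in
        \<open>I\<close>, so it misses \<open>x\<close>, and \<open>x\<close> is outside the lower
        cover.\<close>
      ultimately obtain \<alpha> where \<alpha>: "\<alpha> \<in> I" "x \<in> \<alpha>"
        and min: "\<And>\<beta>. \<beta> \<in> I \<Longrightarrow> x \<in> \<beta> \<Longrightarrow> \<beta> \<subseteq> \<alpha> \<Longrightarrow> \<beta> = \<alpha>"
        using finite_has_minimal[of "{\<beta> \<in> I. x \<in> \<beta>}"] by auto
      have "x \<notin> lower_cover \<alpha>"
        using \<alpha>(1) min I by (fastforce simp: lower_cover_def principal_ideal_def order_ideals_def)
      then show "x \<in> subtuple_join ?k I"
        using \<alpha> \<open>I \<subseteq> P\<close> by (auto simp: subtuple_join_def)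
    qed
  qed
  \<comment> \<open>\<open>P\<close> is itself an order ideal, so the pieces cover everything by the
    join identity at \<open>I = P\<close>.\<close>
  moreover have "\<Union>P = \<Union>F"
    using eq_Union_join_irreducibles[OF assms] P_subset by auto
  moreover have "P \<in> order_ideals P"
    by (auto simp: order_ideals_def)
  ultimately show ?thesis
    using join[of P]
    by (auto simp: birkhoff_partition_def indexed_partition_def subtuple_join_def)
qed

lemma birkhoff_partition_ex1:
  assumes "\<Union>F \<in> F"
  shows "\<exists>!k. birkhoff_partition P (\<Union>F) k"
proof (rule ex_ex1I)
  show "\<exists>k. birkhoff_partition P (\<Union>F) k"
    using birkhoff_partition_exists[OF assms] by blast
  fix k l assume kl: "birkhoff_partition P (\<Union>F) k" "birkhoff_partition P (\<Union>F) l"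
  show "k = l"
  proof (rule extensionalityI)
    show "k \<in> extensional P" "l \<in> extensional P"
      using kl by (auto simp: birkhoff_partition_def indexed_partition_def)
  qed (use kl in \<open>simp add: birkhoff_partition_eq\<close>)
qed

end

subsection \<open>Quotient spaces and sums of tuples\<close>

context vectorspace
begin

section \<open>Subspaces and their dimension\<close>

lemma subspaceI:
  assumes "U \<subseteq> carrier V" "\<zero>\<^bsub>V\<^esub> \<in> U"
    and "\<And>v w. v \<in> U \<Longrightarrow> w \<in> U \<Longrightarrow> v \<oplus>\<^bsub>V\<^esub> w \<in> U"
    and "\<And>c v. c \<in> carrier K \<Longrightarrow> v \<in> U \<Longrightarrow> c \<odot>\<^bsub>V\<^esub> v \<in> U"
  shows "subspace K U V"
  using assms vectorspace_axioms module_axioms by (simp add: subspace_def submodule_def)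

lemma subspaceD:
  assumes "subspace K U V"
  shows "U \<subseteq> carrier V" "\<zero>\<^bsub>V\<^esub> \<in> U"
    and "\<And>v w. v \<in> U \<Longrightarrow> w \<in> U \<Longrightarrow> v \<oplus>\<^bsub>V\<^esub> w \<in> U"
    and "\<And>c v. c \<in> carrier K \<Longrightarrow> v \<in> U \<Longrightarrow> c \<odot>\<^bsub>V\<^esub> v \<in> U"
  using assms by (auto simp: subspace_def submodule_def)

lemma subspace_Int: "subspace K U V \<Longrightarrow> subspace K W V \<Longrightarrow> subspace K (U \<inter> W) V"
  by (rule subspaceI) (auto dest: subspaceD)

text \<open>Independence in \<open>U\<close> and in \<open>V\<close> agree, so independent subsets
  of \<open>U\<close> have at most \<open>dim\<close> elements; a maximal one is a finite basis of
  \<open>U\<close>.\<close>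

lemma subspace_fin_dim:
  assumes "fin_dim" "subspace K U V"
  shows "vectorspace.fin_dim K (vs U)"
proof -
  interpret U: vectorspace K "vs U"
    using assms(2) by (rule subspace_is_vs)
  have sub: "submodule K U V"
    using assms(2) by (simp add: subspace_def)
  have indpt: "U.lin_indpt A \<longleftrightarrow> lin_indpt A" if "A \<subseteq> U" for A
    using span_li_not_depend(2)[OF that sub] by simp
  have "\<exists>A. finite A \<and> maximal A (\<lambda>S. S \<subseteq> carrier (vs U) \<and> U.lin_indpt S)"
  proof (rule maximal_exists)
    fix A assume "A \<subseteq> carrier (vs U) \<and> U.lin_indpt A"
    then show "finite A \<and> card A \<le> dim"
      using indpt[of A] subspaceD(1)[OF assms(2)] li_le_dim[OF assms(1), of A] by auto
  next
    show "{} \<subseteq> carrier (vs U) \<and> U.lin_indpt {}"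
      by (simp add: U.lin_dep_def)
  qed
  then show ?thesis
    using U.max_li_is_basis unfolding U.fin_dim_def U.basis_def by blast
qed

text \<open>Gives access to the theory of additive cosets. Closure under negation comes from scaling
  by -1.\<close>

lemma abelian_subgroup_subspace:
  assumes "subspace K W V"
  shows "abelian_subgroup W V"
proof -
  have "\<ominus>\<^bsub>V\<^esub> w \<in> W" if "w \<in> W" for w
    using that subspaceD[OF assms] smult_minus_1[of w] by (metis R.add.inv_closed R.one_closed subsetD)
  then have "subgroup W (add_monoid V)"
    using subspaceD[OF assms] by unfold_locales (auto simp: a_inv_def)
  then show ?thesis
    using M.abelian_group_axioms by (intro abelian_subgroupI3 additive_subgroupI)
qed

section \<open>The quotient space and its projection\<close>

lemma
  shows carrier_quotient_space: "carrier (quotient_space V W) = quotient_proj V W ` carrier V"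
    and zero_quotient_space: "\<zero>\<^bsub>quotient_space V W\<^esub> = W"
  by (auto simp: quotient_space_def quotient_proj_def A_RCOSETS_def')

lemma quotient_proj_add:
  assumes "subspace K W V" "v \<in> carrier V" "w \<in> carrier V"
  shows "quotient_proj V W v \<oplus>\<^bsub>quotient_space V W\<^esub> quotient_proj V W w =
    quotient_proj V W (v \<oplus>\<^bsub>V\<^esub> w)"
  using abelian_subgroup.a_rcos_sum[OF abelian_subgroup_subspace] assms
  by (simp add: quotient_space_def quotient_proj_def)

lemma quotient_proj_smult:
  assumes W: "subspace K W V" and c: "c \<in> carrier K" and v: "v \<in> carrier V"
  shows "c \<odot>\<^bsub>quotient_space V W\<^esub> quotient_proj V W v = quotient_proj V W (c \<odot>\<^bsub>V\<^esub> v)"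
proof -
  note W' = subspaceD[OF W]
  have "(\<Union>h\<in>W. \<Union>k\<in>W. {c \<odot>\<^bsub>V\<^esub> (h \<oplus>\<^bsub>V\<^esub> v) \<oplus>\<^bsub>V\<^esub> k}) = (\<Union>h\<in>W. {h \<oplus>\<^bsub>V\<^esub> c \<odot>\<^bsub>V\<^esub> v})" (is "?L = ?R")
  proof
    have "c \<odot>\<^bsub>V\<^esub> (h \<oplus>\<^bsub>V\<^esub> v) \<oplus>\<^bsub>V\<^esub> k = (c \<odot>\<^bsub>V\<^esub> h \<oplus>\<^bsub>V\<^esub> k) \<oplus>\<^bsub>V\<^esub> c \<odot>\<^bsub>V\<^esub> v" if "h \<in> W" "k \<in> W" for h k
      using that W'(1) c v by (simp add: smult_r_distr subset_iff M.a_ac)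
    moreover have "c \<odot>\<^bsub>V\<^esub> h \<oplus>\<^bsub>V\<^esub> k \<in> W" if "h \<in> W" "k \<in> W" for h k
      using that W'(3,4) c by blast
    ultimately show "?L \<subseteq> ?R"
      by fastforce
    \<comment> \<open>The summand \<open>W\<close> in the scalar product supplies \<open>h\<close>,
      so no division by \<open>c\<close> occurs and \<open>c = 0\<close> is covered too.\<close>
    have "h \<oplus>\<^bsub>V\<^esub> c \<odot>\<^bsub>V\<^esub> v = c \<odot>\<^bsub>V\<^esub> (\<zero>\<^bsub>V\<^esub> \<oplus>\<^bsub>V\<^esub> v) \<oplus>\<^bsub>V\<^esub> h" if "h \<in> W" for h
      using that W'(1) c v by (simp add: subset_iff M.a_ac)
    then show "?R \<subseteq> ?L"
      using W'(2) by blast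
  qed
  then show ?thesis
    by (simp add: quotient_space_def quotient_proj_def set_add_def' a_r_coset_def')
qed

lemma quotient_proj_eq_zero_iff:
  assumes "subspace K W V" "v \<in> carrier V"
  shows "quotient_proj V W v = W \<longleftrightarrow> v \<in> W"
proof -
  interpret abelian_subgroup W V
    using assms(1) by (rule abelian_subgroup_subspace)
  show ?thesis
    using a_rcos_self[OF assms(2)] a_rcos_const by (auto simp: quotient_proj_def)
qed

text \<open>Every coset is a projection value and the projection respects both operations, so each
  axiom is inherited from \<open>V\<close>.\<close>

lemma vectorspace_quotient_space:
  assumes W: "subspace K W V"
  shows "vectorspace K (quotient_space V W)"
proof -
  note hom = quotient_proj_add[OF W] quotient_proj_smult[OF W]
  have zero: "\<zero>\<^bsub>quotient_space V W\<^esub> = quotient_proj V W \<zero>\<^bsub>V\<^esub>"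
    using quotient_proj_eq_zero_iff[OF W, of "\<zero>\<^bsub>V\<^esub>"] subspaceD(2)[OF W] by (simp add: zero_quotient_space)
  have "\<exists>y\<in>carrier V. quotient_proj V W x \<oplus>\<^bsub>quotient_space V W\<^esub> quotient_proj V W y =
      quotient_proj V W \<zero>\<^bsub>V\<^esub>" if "x \<in> carrier V" for x
    using that hom(1)[of x "\<ominus>\<^bsub>V\<^esub> x"] by (intro bexI[of _ "\<ominus>\<^bsub>V\<^esub> x"]) (auto simp: M.r_neg)
  then show ?thesis
    by (intro vs_criteria)
      (auto simp: carrier_quotient_space zero hom field_axioms M.a_ac smult_assoc1 smult_l_distr
        smult_r_distr)
qed

text \<open>The domain is an arbitrary subspace \<open>U\<close>, so that rank-nullity can be
  applied to each restriction of the projection.\<close>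

lemma linear_map_quotient_proj:
  assumes W: "subspace K W V" and U: "subspace K U V"
  shows "linear_map K (vs U) (quotient_space V W) (quotient_proj V W)"
proof -
  interpret U: vectorspace K "vs U"
    using U by (rule subspace_is_vs)
  interpret Q: vectorspace K "quotient_space V W"
    using W by (rule vectorspace_quotient_space)
  have "quotient_proj V W \<in> module_hom K (vs U) (quotient_space V W)"
    using subspaceD(1)[OF U]
    by (auto simp: module_hom_def carrier_quotient_space quotient_proj_add[OF W] quotient_proj_smult[OF W]
        subset_iff)
  then show ?thesis
    by unfold_locales
qed

lemma subspace_quotient_proj_image:
  assumes W: "subspace K W V" and U: "subspace K U V"
  shows "subspace K (quotient_proj V W ` U) (quotient_space V W)"
proof -
  interpret linear_map K "vs U" "quotient_space V W" "quotient_proj V W"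
    using W U by (rule linear_map_quotient_proj)
  show ?thesis
    using imT_is_subspace by (simp add: im_def)
qed

text \<open>Rank-nullity for the projection restricted to \<open>U\<close>, whose kernel is
  \<open>U \<inter> W\<close>. Monotonicity of dimension, the modular law and the quotient defects
  all come from this formula.\<close>

lemma dim_quotient_proj_image:
  assumes fd: "fin_dim" and W: "subspace K W V" and U: "subspace K U V"
  shows "vectorspace.dim K ((quotient_space V W)\<lparr>carrier := quotient_proj V W ` U\<rparr>)
    + vectorspace.dim K (vs (U \<inter> W)) = vectorspace.dim K (vs U)"
proof -
  interpret T: linear_map K "vs U" "quotient_space V W" "quotient_proj V W"
    using W U by (rule linear_map_quotient_proj)
  have "T.kerT = U \<inter> W"
    using subspaceD(1)[OF U] quotient_proj_eq_zero_iff[OF W]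
    by (auto simp: T.ker_def zero_quotient_space)
  then show ?thesis
    using T.rank_nullity[OF subspace_fin_dim[OF fd U]] by (simp add: T.im_def)
qed

lemma dim_mono:
  assumes "fin_dim" "subspace K W V" "subspace K U V" "W \<subseteq> U"
  shows "vectorspace.dim K (vs W) \<le> vectorspace.dim K (vs U)"
  using dim_quotient_proj_image[OF assms(1-3)] assms(4) by (simp add: inf_absorb2)

section \<open>Sums of tuples and their images in quotients\<close>

lemma subspace_finsum:
  assumes U: "subspace K U V" and "finite S" "x \<in> S \<rightarrow> U"
  shows "finsum V x S \<in> U"
  using assms(2,3)
proof induction
  case (insert i S)
  have "x \<in> S \<rightarrow> carrier V" "x i \<in> carrier V"
    using insert.prems subspaceD(1)[OF U] by auto
  then show ?case
    using insert subspaceD(3)[OF U] by auto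
qed (use subspaceD[OF U] in simp)

text \<open>Together with \<open>subspace_tuple_sum\<close> and \<open>subset_tuple_sum\<close> this
  makes the sum the smallest subspace containing all entries; most later inclusions use that instead
  of explicit families.\<close>

lemma tuple_sum_least:
  assumes "finite S" "subspace K U V" "\<And>i. i \<in> S \<Longrightarrow> L i \<subseteq> U"
  shows "tuple_sum V L S \<subseteq> U"
  using assms by (auto simp: tuple_sum_def intro!: subspace_finsum)

lemma subspace_tuple_sum:
  assumes S: "finite S" and L: "\<And>i. i \<in> S \<Longrightarrow> subspace K (L i) V"
  shows "subspace K (tuple_sum V L S) V"
proof (rule subspaceI)
  note LD = subspaceD[OF L]
  have carr: "x \<in> S \<rightarrow> carrier V" if "x \<in> Pi S L" for x
    using that LD(1) by (auto simp: Pi_iff)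
  show "tuple_sum V L S \<subseteq> carrier V"
    using carr by (auto simp: tuple_sum_def)
  have "finsum V (\<lambda>_. \<zero>\<^bsub>V\<^esub>) S \<in> tuple_sum V L S"
    unfolding tuple_sum_def using LD(2) by blast
  then show "\<zero>\<^bsub>V\<^esub> \<in> tuple_sum V L S"
    by simp
next
  fix v w assume "v \<in> tuple_sum V L S" "w \<in> tuple_sum V L S"
  then obtain x y where x: "x \<in> Pi S L" "v = finsum V x S" and y: "y \<in> Pi S L" "w = finsum V y S"
    by (auto simp: tuple_sum_def)
  have "x \<in> S \<rightarrow> carrier V" "y \<in> S \<rightarrow> carrier V"
    using x y subspaceD(1)[OF L] by (auto simp: Pi_iff)
  then have "v \<oplus>\<^bsub>V\<^esub> w = finsum V (\<lambda>i. x i \<oplus>\<^bsub>V\<^esub> y i) S"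
    using x y by (simp add: M.finsum_addf)
  moreover have "(\<lambda>i. x i \<oplus>\<^bsub>V\<^esub> y i) \<in> Pi S L"
    using x y subspaceD(3)[OF L] by (auto simp: Pi_iff)
  ultimately show "v \<oplus>\<^bsub>V\<^esub> w \<in> tuple_sum V L S"
    unfolding tuple_sum_def by blast
next
  fix c v assume c: "c \<in> carrier K" and "v \<in> tuple_sum V L S"
  then obtain x where x: "x \<in> Pi S L" "v = finsum V x S"
    by (auto simp: tuple_sum_def)
  have "x \<in> S \<rightarrow> carrier V"
    using x subspaceD(1)[OF L] by (auto simp: Pi_iff)
  then have "c \<odot>\<^bsub>V\<^esub> v = finsum V (\<lambda>i. c \<odot>\<^bsub>V\<^esub> x i) S"
    using x c by (simp add: finsum_smult)
  moreover have "(\<lambda>i. c \<odot>\<^bsub>V\<^esub> x i) \<in> Pi S L"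
    using x c subspaceD(4)[OF L] by (auto simp: Pi_iff)
  ultimately show "c \<odot>\<^bsub>V\<^esub> v \<in> tuple_sum V L S"
    unfolding tuple_sum_def by blast
qed

lemma subset_tuple_sum:
  assumes S: "finite S" and L: "\<And>i. i \<in> S \<Longrightarrow> subspace K (L i) V" and "i \<in> S"
  shows "L i \<subseteq> tuple_sum V L S"
proof
  fix v assume v: "v \<in> L i"
  \<comment> \<open>The family concentrated at \<open>i\<close> has sum \<open>v\<close>, and zero
    is available in every other entry.\<close>
  let ?x = "\<lambda>j. if i = j then v else \<zero>\<^bsub>V\<^esub>"
  have "v \<in> carrier V"
    using v subspaceD(1)[OF L[OF assms(3)]] by blast
  then have "finsum V ?x S = v"
    using M.finsum_singleton[OF assms(3) S, of "\<lambda>_. v"] by simp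
  moreover have "?x \<in> Pi S L"
    using v subspaceD(2)[OF L] by auto
  ultimately show "v \<in> tuple_sum V L S"
    unfolding tuple_sum_def by (intro CollectI exI[of _ ?x]) simp
qed

lemma tuple_sum_mono:
  assumes "finite T" "\<And>i. i \<in> T \<Longrightarrow> subspace K (L i) V" "S \<subseteq> T"
  shows "tuple_sum V L S \<subseteq> tuple_sum V L T"
  using assms by (intro tuple_sum_least subspace_tuple_sum subset_tuple_sum) (auto intro: finite_subset)

lemma quotient_proj_finsum:
  assumes W: "subspace K W V" and "finite S" "x \<in> S \<rightarrow> carrier V"
  shows "quotient_proj V W (finsum V x S) = finsum (quotient_space V W) (\<lambda>i. quotient_proj V W (x i)) S"
proof -
  interpret Q: vectorspace K "quotient_space V W"
    using W by (rule vectorspace_quotient_space)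
  show ?thesis
    using assms(2,3)
  proof induction
    case empty
    then show ?case
      using quotient_proj_eq_zero_iff[OF W] subspaceD(2)[OF W] by (simp add: zero_quotient_space)
  next
    case (insert i S)
    then have "(\<lambda>i. quotient_proj V W (x i)) \<in> S \<rightarrow> carrier (quotient_space V W)"
      "quotient_proj V W (x i) \<in> carrier (quotient_space V W)"
      by (auto simp: carrier_quotient_space)
    then show ?case
      using insert by (simp add: quotient_proj_add[OF W, symmetric])
  qed
qed

text \<open>One inclusion is minimality of the sum in the quotient; the other pushes the projection
  through a finite sum.\<close>

lemma tuple_sum_quotient_proj:
  assumes W: "subspace K W V" and S: "finite S" and L: "\<And>i. i \<in> S \<Longrightarrow> subspace K (L i) V"
  shows "tuple_sum (quotient_space V W) (\<lambda>i. quotient_proj V W ` L i) S =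
    quotient_proj V W ` tuple_sum V L S"
proof
  interpret Q: vectorspace K "quotient_space V W"
    using W by (rule vectorspace_quotient_space)
  show "tuple_sum (quotient_space V W) (\<lambda>i. quotient_proj V W ` L i) S \<subseteq>
      quotient_proj V W ` tuple_sum V L S"
    using assms
    by (intro Q.tuple_sum_least subspace_quotient_proj_image subspace_tuple_sum image_mono subset_tuple_sum)
  show "quotient_proj V W ` tuple_sum V L S \<subseteq>
      tuple_sum (quotient_space V W) (\<lambda>i. quotient_proj V W ` L i) S"
  proof
    fix v assume "v \<in> quotient_proj V W ` tuple_sum V L S"
    then obtain x where x: "x \<in> Pi S L" "v = quotient_proj V W (finsum V x S)"
      by (auto simp: tuple_sum_def)
    then have "v = finsum (quotient_space V W) (\<lambda>i. quotient_proj V W (x i)) S"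
      using subspaceD(1)[OF L] by (subst x(2), intro quotient_proj_finsum W S) (auto simp: Pi_iff)
    moreover have "(\<lambda>i. quotient_proj V W (x i)) \<in> (\<Pi> i\<in>S. quotient_proj V W ` L i)"
      using x(1) by auto
    ultimately show "v \<in> tuple_sum (quotient_space V W) (\<lambda>i. quotient_proj V W ` L i) S"
      unfolding tuple_sum_def by blast
  qed
qed

end

subsection \<open>Defects of subtuples and quotients\<close>

locale finite_subspace_tuple = vectorspace K V
  for K :: "('a, 'b) ring_scheme" and V :: "('a, 'c, 'd) module_scheme" +
  fixes L :: "'i \<Rightarrow> 'c set" and N :: "'i set"
  assumes fin_dim: "fin_dim"
    and finite_index: "finite N"
    and subspace_entry: "i \<in> N \<Longrightarrow> subspace K (L i) V"
begin

lemma finite_index_subset: "S \<subseteq> N \<Longrightarrow> finite S"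
  using finite_index by (rule rev_finite_subset)

lemma subspace_subtuple_sum: "S \<subseteq> N \<Longrightarrow> subspace K (tuple_sum V L S) V"
  using subspace_entry by (intro subspace_tuple_sum finite_index_subset) auto

lemma subtuple_sum_mono: "S \<subseteq> T \<Longrightarrow> T \<subseteq> N \<Longrightarrow> tuple_sum V L S \<subseteq> tuple_sum V L T"
  using subspace_entry by (intro tuple_sum_mono finite_index_subset) auto

lemma quotient_sum:
  assumes "S \<subseteq> N" "T \<subseteq> N"
  shows "tuple_sum (quotient_space V (tuple_sum V L S)) (quotient_family V L S) T =
    quotient_proj V (tuple_sum V L S) ` tuple_sum V L T"
  unfolding quotient_family_def using assms subspace_entry
  by (intro tuple_sum_quotient_proj subspace_subtuple_sum finite_index_subset) auto

lemma subspace_quotient_family: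
  assumes "S \<subseteq> N" "i \<in> N"
  shows "subspace K (quotient_family V L S i) (quotient_space V (tuple_sum V L S))"
  unfolding quotient_family_def
  using assms by (intro subspace_quotient_proj_image subspace_subtuple_sum subspace_entry)

text \<open>The entries indexed by \<open>S\<close> become zero in the quotient by \<open>\<langle>S\<rangle>\<close>.\<close>

lemma quotient_proj_sum_Un:
  assumes "S \<subseteq> N" "T \<subseteq> N"
  shows "quotient_proj V (tuple_sum V L S) ` tuple_sum V L (S \<union> T) =
    quotient_proj V (tuple_sum V L S) ` tuple_sum V L T"
proof
  let ?W = "tuple_sum V L S"
  interpret Q: vectorspace K "quotient_space V ?W"
    using assms by (intro vectorspace_quotient_space subspace_subtuple_sum)
  have sub: "subspace K (quotient_proj V ?W ` tuple_sum V L T) (quotient_space V ?W)"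
    using assms by (intro subspace_quotient_proj_image subspace_subtuple_sum)
  have "quotient_family V L S i \<subseteq> quotient_proj V ?W ` tuple_sum V L T" if i: "i \<in> S \<union> T" for i
  proof (cases "i \<in> T")
    case True
    then show ?thesis
      unfolding quotient_family_def
      using assms subspace_entry by (intro image_mono subset_tuple_sum finite_index_subset) auto
  next
    case False
    then have "L i \<subseteq> ?W"
      using i assms subspace_entry by (intro subset_tuple_sum finite_index_subset) auto
    then have "quotient_family V L S i \<subseteq> {\<zero>\<^bsub>quotient_space V ?W\<^esub>}"
      using quotient_proj_eq_zero_iff[OF subspace_subtuple_sum[OF assms(1)]] subspaceD(1)[OF subspace_subtuple_sum[OF assms(1)]]
      by (auto simp: quotient_family_def zero_quotient_space)
    then show ?thesis
      using Q.subspaceD(2)[OF sub] by blast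
  qed
  then have "tuple_sum (quotient_space V ?W) (quotient_family V L S) (S \<union> T) \<subseteq>
      quotient_proj V ?W ` tuple_sum V L T"
    using assms sub by (intro Q.tuple_sum_least finite_index_subset) auto
  then show "quotient_proj V ?W ` tuple_sum V L (S \<union> T) \<subseteq> quotient_proj V ?W ` tuple_sum V L T"
    using assms by (simp add: quotient_sum)
qed (use assms in \<open>intro image_mono subtuple_sum_mono, auto\<close>)

text \<open>The dimension formula is applied to \<langle>S \<union> T\<rangle>, which contains
  \<langle>S\<rangle> and has the same image in the quotient as \<langle>T\<rangle>.\<close>

lemma dim_quotient_sum:
  assumes "S \<subseteq> N" "T \<subseteq> N"
  shows "vectorspace.dim K ((quotient_space V (tuple_sum V L S))
      \<lparr>carrier := quotient_proj V (tuple_sum V L S) ` tuple_sum V L T\<rparr>)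
    + vectorspace.dim K (vs (tuple_sum V L S)) = vectorspace.dim K (vs (tuple_sum V L (S \<union> T)))"
  using dim_quotient_proj_image[OF fin_dim subspace_subtuple_sum[OF assms(1)], of "tuple_sum V L (S \<union> T)"]
    subspace_subtuple_sum[of "S \<union> T"] subtuple_sum_mono[of S "S \<union> T"] assms quotient_proj_sum_Un[OF assms]
  by (simp add: inf_absorb2)

text \<open>Dimensions subtract by \<open>dim_quotient_sum\<close>; disjointness makes cardinalities
  subtract in the same way.\<close>

lemma defect_quotient:
  assumes "S \<subseteq> N" "T \<subseteq> N" "S \<inter> T = {}"
  shows "defect K (quotient_space V (tuple_sum V L S)) (quotient_family V L S) T =
    defect K V L (S \<union> T) - defect K V L S"
  using dim_quotient_sum[OF assms(1,2)] quotient_sum[OF assms(1,2)] assms finite_index_subset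
  by (simp add: defect_def card_Un_disjoint)

lemma defect_submodular:
  assumes "S \<subseteq> N" "T \<subseteq> N"
  shows "defect K V L (S \<union> T) + defect K V L (S \<inter> T) \<le> defect K V L S + defect K V L T"
proof -
  let ?\<sigma> = "tuple_sum V L"
  have "vectorspace.dim K (vs (?\<sigma> (S \<inter> T))) \<le> vectorspace.dim K (vs (?\<sigma> T \<inter> ?\<sigma> S))"
    using assms by (intro dim_mono fin_dim subspace_Int subspace_subtuple_sum Int_greatest subtuple_sum_mono) auto
  \<comment> \<open>The modular law, obtained by computing the dimension of the image of
    \<langle>T\<rangle> modulo \<langle>S\<rangle> in two ways.\<close>
  moreover have "vectorspace.dim K (vs (?\<sigma> (S \<union> T))) + vectorspace.dim K (vs (?\<sigma> T \<inter> ?\<sigma> S)) =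
      vectorspace.dim K (vs (?\<sigma> S)) + vectorspace.dim K (vs (?\<sigma> T))"
    using dim_quotient_sum[OF assms]
      dim_quotient_proj_image[OF fin_dim subspace_subtuple_sum[OF assms(1)] subspace_subtuple_sum[OF assms(2)]]
    by simp
  moreover have "card S + card T = card (S \<union> T) + card (S \<inter> T)"
    using assms finite_index_subset by (intro card_Un_Int)
  ultimately show ?thesis
    by (simp add: defect_def)
qed

end

section \<open>The lattice of BK-subtuples and its irreducible quotients\<close>

lemma subspace_tuple_mono: "subspace_tuple K V L N \<Longrightarrow> S \<subseteq> N \<Longrightarrow> subspace_tuple K V L S"
  by (auto simp: subspace_tuple_def intro: finite_subset)

text \<open>Linear independence passes to subtuples, so only the vanishing of the defect remains to
  be required.\<close>

lemma BK_subtuples_eq: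
  assumes "lin_indep_tuple K V L N"
  shows "BK_subtuples K V L N = {S. S \<subseteq> N \<and> defect K V L S = 0}"
  using assms subspace_tuple_mono
  by (fastforce simp: BK_subtuples_def BK_tuple_def lin_indep_tuple_def)

context finite_subspace_tuple
begin

lemma ring_of_sets_BK_subtuples:
  assumes "lin_indep_tuple K V L N"
  shows "ring_of_sets_lattice (BK_subtuples K V L N)"
proof
  have nonneg: "0 \<le> defect K V L S" if "S \<subseteq> N" for S
    using assms that by (simp add: lin_indep_tuple_def)
  have F: "BK_subtuples K V L N = {S. S \<subseteq> N \<and> defect K V L S = 0}"
    using assms by (rule BK_subtuples_eq)
  show "finite (\<Union>(BK_subtuples K V L N))"
    unfolding F by (intro finite_subset[OF _ finite_index]) auto
  show "{} \<in> BK_subtuples K V L N"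
  proof -
    have "tuple_sum V L {} = {\<zero>\<^bsub>V\<^esub>}"
      by (simp add: tuple_sum_def)
    moreover have "vectorspace.dim K (vs {\<zero>\<^bsub>V\<^esub>}) = 0"
    proof -
      interpret Z: vectorspace K "vs {\<zero>\<^bsub>V\<^esub>}"
        by (intro subspace_is_vs subspaceI) auto
      \<comment> \<open>The empty set spans the zero space, so its dimension is at most 0.\<close>
      show ?thesis
        using Z.gen_ge_dim[of "{}"] Z.span_empty by simp
    qed
    ultimately show ?thesis
      by (simp add: F defect_def)
  qed
  fix A B assume "A \<in> BK_subtuples K V L N" "B \<in> BK_subtuples K V L N"
  then have AB: "A \<subseteq> N" "B \<subseteq> N" "defect K V L A = 0" "defect K V L B = 0"
    by (auto simp: F)
  \<comment> \<open>By submodularity the two non-negative defects of union and intersection add up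
    to at most 0, so both vanish.\<close>
  have "A \<union> B \<subseteq> N" "A \<inter> B \<subseteq> N"
    using AB by auto
  then show "A \<union> B \<in> BK_subtuples K V L N" "A \<inter> B \<in> BK_subtuples K V L N"
    using defect_submodular[OF AB(1,2)] AB nonneg[of "A \<union> B"] nonneg[of "A \<inter> B"] by (auto simp: F)
qed

text \<open>Formulated for consecutive members \<open>S\<close> and \<open>T\<close> of the lattice;
  it is applied to a join-irreducible and its lower cover.\<close>

lemma irreducible_quotient:
  assumes indep: "lin_indep_tuple K V L N"
    and S: "S \<in> BK_subtuples K V L N" and T: "T \<in> BK_subtuples K V L N" and "S \<subset> T"
    and max: "\<And>A. A \<in> BK_subtuples K V L N \<Longrightarrow> S \<subseteq> A \<Longrightarrow> A \<subset> T \<Longrightarrow> A = S"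
  shows "irreducible_BK_tuple K (quotient_space V (tuple_sum V L S)) (quotient_family V L S) (T - S)"
proof -
  let ?d = "defect K (quotient_space V (tuple_sum V L S)) (quotient_family V L S)"
  note F = BK_subtuples_eq[OF indep]
  have N: "S \<subseteq> N" "T \<subseteq> N" and zero: "defect K V L S = 0" "defect K V L T = 0"
    using S T by (auto simp: F)
  have eq: "?d R = defect K V L (S \<union> R)" if "R \<subseteq> T - S" for R
    using defect_quotient[of S R] that N zero by auto
  have nonneg: "0 \<le> ?d R" if "R \<subseteq> T - S" for R
  proof -
    have "S \<union> R \<subseteq> N"
      using that N by auto
    then show ?thesis
      using indep by (simp add: eq[OF that] lin_indep_tuple_def)
  qed
  have "?d (T - S) = 0"
    using eq[of "T - S"] zero \<open>S \<subset> T\<close> by (simp add: Un_absorb1 psubset_imp_subset)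
  moreover have "0 < ?d R" if R: "R \<noteq> {}" "R \<subset> T - S" for R
  proof -
    \<comment> \<open>A zero defect would turn \<open>S \<union> R\<close> into a BK-subtuple
      strictly between \<open>S\<close> and \<open>T\<close>, against \<open>max\<close>.\<close>
    have "S \<subseteq> S \<union> R" "S \<union> R \<subset> T" "S \<union> R \<noteq> S" "S \<union> R \<subseteq> N"
      using R N \<open>S \<subset> T\<close> by auto
    then have "defect K V L (S \<union> R) \<noteq> 0"
      using max[of "S \<union> R"] by (auto simp: F)
    then show ?thesis
      using eq[of R] nonneg[of R] R by auto
  qed
  moreover have "subspace_tuple K (quotient_space V (tuple_sum V L S)) (quotient_family V L S) (T - S)"
    using N subspace_quotient_family finite_index_subset[OF N(2)] by (auto simp: subspace_tuple_def)
  ultimately show ?thesis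
    using nonneg \<open>S \<subset> T\<close> by (auto simp: irreducible_BK_tuple_def BK_tuple_def lin_indep_tuple_def)
qed

end

text \<open>The first two conjuncts say that \<open>Union\<close> is a bijective order embedding,
  which is Birkhoff's isomorphism. In the last one, \<open>T\<close> and \<open>S\<close> are the
  subtuples of (\<alpha>) and (\<alpha>) - {\<alpha>}, and quantifying over \<open>k\<close> refers
  to the unique partition.\<close>

theorem theorem3p12:
  fixes K :: "('a, 'b) ring_scheme"
    and V :: "('a, 'c, 'd) module_scheme"
    and L :: "'i \<Rightarrow> 'c set"
    and N :: "'i set"
  assumes "vectorspace K V"
    and "vectorspace.fin_dim K V"
    and "reducible_BK_tuple K V L N"
  shows "bij_betw Union (order_ideals (BK_poset K V L N)) (BK_subtuples K V L N)
    \<and> (\<forall>I\<in>order_ideals (BK_poset K V L N). \<forall>J\<in>order_ideals (BK_poset K V L N).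
         \<Union>I \<subseteq> \<Union>J \<longleftrightarrow> I \<subseteq> J)
    \<and> (\<exists>!k. birkhoff_partition (BK_poset K V L N) N k)
    \<and> (\<forall>k. birkhoff_partition (BK_poset K V L N) N k \<longrightarrow>
         (\<forall>\<alpha>\<in>BK_poset K V L N.
            let T = subtuple_join k (principal_ideal (BK_poset K V L N) \<alpha>);
                S = subtuple_join k (principal_ideal (BK_poset K V L N) \<alpha> - {\<alpha>})
            in irreducible_BK_tuple K (quotient_space V (tuple_sum V L S))
                 (quotient_family V L S) (T - S)))"
proof -
  let ?F = "BK_subtuples K V L N" and ?P = "BK_poset K V L N"
  have BK: "BK_tuple K V L N"
    using assms(3) by (simp add: reducible_BK_tuple_def)
  then have indep: "lin_indep_tuple K V L N"
    by (simp add: BK_tuple_def)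
  then have "subspace_tuple K V L N"
    by (simp add: lin_indep_tuple_def)
  then interpret finite_subspace_tuple K V L N
    using assms(1,2)
    by (simp add: finite_subspace_tuple_def finite_subspace_tuple_axioms_def subspace_tuple_def)
  interpret lat: ring_of_sets_lattice ?F
    using indep by (rule ring_of_sets_BK_subtuples)
  \<comment> \<open>As a BK-tuple, \<open>N\<close> is the top of the lattice; this identifies the
    set to be partitioned with \<open>\<Union>?F\<close>.\<close>
  have "N \<in> ?F"
    using BK by (simp add: BK_subtuples_def)
  moreover from this have top: "\<Union>?F = N"
    by (auto simp: BK_subtuples_def)
  ultimately have top_mem: "\<Union>?F \<in> ?F"
    by simp
  have P: "?P = join_irreducibles ?F"
    by (simp add: BK_poset_def)
  have "irreducible_BK_tuple K (quotient_space V (tuple_sum V L S)) (quotient_family V L S) (T - S)"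
    if k: "birkhoff_partition ?P N k" and \<alpha>: "\<alpha> \<in> ?P"
      and T: "T = subtuple_join k (principal_ideal ?P \<alpha>)"
      and S: "S = subtuple_join k (principal_ideal ?P \<alpha> - {\<alpha>})" for k \<alpha> T S
  proof -
    \<comment> \<open>Both index sets are order ideals, so the partition property turns the joins of
      pieces into unions of ideals.\<close>
    have "T = \<alpha>" "S = lat.lower_cover \<alpha>"
      using k \<alpha> lat.principal_ideal_in_order_ideals lat.Union_principal_ideal
      by (auto simp: S T P birkhoff_partition_def lat.lower_cover_def)
    moreover have "\<alpha> \<in> ?F"
      using \<alpha> lat.P_subset by (auto simp: P)
    moreover have "A = lat.lower_cover \<alpha>" if "A \<in> ?F" "lat.lower_cover \<alpha> \<subseteq> A" "A \<subset> \<alpha>" for A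
      using lat.subset_lower_cover[OF that(1,3)] that(2) by (rule subset_antisym)
    ultimately show ?thesis
      using \<alpha> lat.lower_cover_mem lat.lower_cover_psubset
      by (intro irreducible_quotient[OF indep]) (simp_all add: P)
  qed
  then show ?thesis
    using lat.bij_betw_Union_order_ideals lat.Union_order_ideal_subset_iff
      lat.birkhoff_partition_ex1[OF top_mem]
    by (auto simp: P top Let_def)
qed

end
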